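(* Let $x\in X$ be a stationary point of the problem $\min_{x\in X}f(x)$. Then either $x\in\mathcal{X}^*$ or $$\Big(\frac{\mu}{\rho}\Big)^{\frac{\delta}{\delta(1+\nu)-1}}\le\operatorname{dist}(x;\mathcal{X}^* ).$$
   Context: $\|\cdot\|$ is the Euclidean norm on $\mathbb{R}^n$, $\operatorname{dist}(x;S)=\inf_{z\in S}\|z-x\|$, and $\operatorname{dom}(f)=\{x:f(x)<+\infty\}$. Standing assumptions: $f:\mathbb{R}^n\to\mathbb{R}\cup\{+\infty\}$ is proper; $X\subseteq\operatorname{dom}(f)$ is nonempty, closed and convex; the set of minimizers $\mathcal{X}^*=\operatorname{argmin}_{x\in X}f(x)$ is nonempty and $f^*$ is the minimal value of $f$ over $X$. The parameters satisfy $\rho>0$, $0<\nu\le1$, $\frac1{1+\nu}<\delta\le1$, $\mu>0$, and: (i) $f$ is $\nu$-paraconvex with constant $\rho$ on an open convex set $X'$ with $X\subseteq X'\subseteq\operatorname{dom}(f)$, i.e. $f(\lambda x+(1-\lambda)y)\le\lambda f(x)+(1-\lambda)f(y)+\rho\min\{\lambda,1-\lambda\}\|x-y\|^{1+\nu}$ for all $x,y\in X'$, $\lambda\in[0,1]$ (consequently $f$ is locally Lipschitz on $X'$); (ii) $f$ admits a Hölderian error bound of order $\delta$ with constant $\mu$ on $X$: $\mu\operatorname{dist}^{1/\delta}(x;\mathcal{X}^* )\le f(x)-f^*$ for all $x\in X$. A point $\bar x\in X$ is stationary for $\min_{x\in X}f(x)$ if $0\in\partial(f+\delta_X)(\bar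 x)$, where $\delta_X$ is the indicator function of $X$ ($0$ on $X$, $+\infty$ elsewhere; not to be confused with the number $\delta$) and $\partial$ is the Clarke subdifferential (in its extended form for lower semicontinuous extended-real-valued functions, defined through the Clarke normal cone to the epigraph). *)

theory Defs
  imports "HOL-Analysis.Analysis"
begin

definition proper :: "('a \<Rightarrow> ereal) \<Rightarrow> bool" where
  "proper f \<longleftrightarrow> (\<forall>x. f x \<noteq> -\<infinity>) \<and> (\<exists>x. f x < \<infinity>)"

definition effective_dom :: "('a \<Rightarrow> ereal) \<Rightarrow> 'a set" where
  "effective_dom f = {x. f x < \<infinity>}"

definition epigraph_ext :: "('a \<Rightarrow> ereal) \<Rightarrow> ('a \<times> real) set" where
  "epigraph_ext f = {(x, r). f x \<le> ereal r}"

definition convex_indicator :: "'a set \<Rightarrow> 'a \<Rightarrow> ereal" where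
  "convex_indicator X x = (if x \<in> X then 0 else \<infinity>)"

definition minimizers :: "('a \<Rightarrow> ereal) \<Rightarrow> 'a set \<Rightarrow> 'a set" where
  "minimizers f X = {x. is_arg_min f (\<lambda>y. y \<in> X) x}"

definition min_value :: "('a \<Rightarrow> ereal) \<Rightarrow> 'a set \<Rightarrow> ereal" where
  "min_value f X = (INF x\<in>X. f x)"

(* Clarke's generalized directional derivative of g at x in direction v:
   the limsup of (g (y + t v) - g y) / t as y tends to x (y = x allowed) and t decreases to 0. *)
definition clarke_dir_deriv ::
    "('a::real_normed_vector \<Rightarrow> real) \<Rightarrow> 'a \<Rightarrow> 'a \<Rightarrow> ereal" where
  "clarke_dir_deriv g x v =
     Limsup (nhds x \<times>\<^sub>F at_right 0) (\<lambda>(y, t). ereal ((g (y + t *\<^sub>R v) - g y) / t))"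

(* Clarke's original definition (Optimization and Nonsmooth Analysis, Section 2.4), meant for
   x in S: tangent directions are those in which the generalized directional derivative of the
   distance function to S vanishes; the normal cone is the polar of the tangent cone. *)
definition clarke_tangent_cone :: "'a::euclidean_space set \<Rightarrow> 'a \<Rightarrow> 'a set" where
  "clarke_tangent_cone S x = {v. clarke_dir_deriv (\<lambda>y. infdist y S) x v = 0}"

definition clarke_normal_cone :: "'a::euclidean_space set \<Rightarrow> 'a \<Rightarrow> 'a set" where
  "clarke_normal_cone S x = {z. \<forall>v\<in>clarke_tangent_cone S x. z \<bullet> v \<le> 0}"

(* Empty where f is not finite.  The norm and inner product on the product type are the
   Euclidean ones. *)
definition clarke_subdiff ::
    "('a::euclidean_space \<Rightarrow> ereal) \<Rightarrow> 'a \<Rightarrow> 'a set" where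
  "clarke_subdiff f x =
     {z. \<bar>f x\<bar> \<noteq> \<infinity> \<and> (z, -1) \<in> clarke_normal_cone (epigraph_ext f) (x, real_of_ereal (f x))}"

definition stationary_point ::
    "('a::euclidean_space \<Rightarrow> ereal) \<Rightarrow> 'a set \<Rightarrow> 'a \<Rightarrow> bool" where
  "stationary_point f X x \<longleftrightarrow>
     x \<in> X \<and> 0 \<in> clarke_subdiff (\<lambda>y. f y + convex_indicator X y) x"

definition paraconvex_on ::
    "'a::real_normed_vector set \<Rightarrow> real \<Rightarrow> real \<Rightarrow> ('a \<Rightarrow> ereal) \<Rightarrow> bool" where
  "paraconvex_on C \<nu> \<rho> f \<longleftrightarrow>
     (\<forall>x\<in>C. \<forall>y\<in>C. \<forall>l\<in>{0..1}.
        f (l *\<^sub>R x + (1 - l) *\<^sub>R y) \<le>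
          ereal l * f x + ereal (1 - l) * f y
          + ereal (\<rho> * min l (1 - l) * norm (x - y) powr (1 + \<nu>)))"

definition holder_error_bound_on ::
    "'a::metric_space set \<Rightarrow> real \<Rightarrow> real \<Rightarrow> ('a \<Rightarrow> ereal) \<Rightarrow> bool" where
  "holder_error_bound_on X \<delta> \<mu> f \<longleftrightarrow>
     (\<forall>x\<in>X. ereal (\<mu> * infdist x (minimizers f X) powr (1 / \<delta>)) \<le> f x - min_value f X)"

end

theory Submission
  imports Defs
begin

text \<open>
  The heart of the matter is that a stationary point \<open>x\<close> satisfies
  \<open>f x - f y \<le> \<rho> * norm (x - y) powr (1 + \<nu>)\<close> for every \<open>y \<in> X\<close>
  (\<open>stationary_point_gap_le\<close>). Otherwise, by paraconvexity, moving from \<open>x\<close> towards \<open>y\<close>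
  decreases \<open>f\<close> at a positive rate, and a smaller rate \<open>s > 0\<close> works from all points of the
  epigraph near \<open>(x, f x)\<close>. This uniformity makes \<open>(y - x, - s)\<close> a Clarke tangent direction
  of the epigraph (by the criterion \<open>clarke_tangent_coneI\<close>), and its inner product with \<open>(0, -1)\<close> is \<open>s > 0\<close>,
  which stationarity forbids.

  Taking the infimum over all minimizers \<open>y\<close>, and writing \<open>D\<close> for the distance from \<open>x\<close> to the
  minimizers, the error bound gives \<open>\<mu> * D powr (1 / \<delta>) \<le> \<rho> * D powr (1 + \<nu>)\<close>. If \<open>x\<close> is not a
  minimizer then \<open>D > 0\<close>, and since \<open>1 + \<nu> > 1 / \<delta>\<close> this can be solved for a lower bound on \<open>D\<close>.
\<close>

lemma infdist_approx:
  assumes "S \<noteq> {}" "\<eta> > 0"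
  obtains w where "w \<in> S" "dist y w < infdist y S + \<eta>"
proof -
  have "(INF a\<in>S. dist y a) < infdist y S + \<eta>"
    using assms by (simp add: infdist_notempty)
  then show thesis
    using that assms(1) by (subst (asm) cINF_less_iff) auto
qed

text \<open>
  Clarke's definition looks at the distance function around \<open>z\<close>, also off \<open>S\<close>. Points off \<open>S\<close>
  can be replaced by nearly closest points of \<open>S\<close>, because translating both by \<open>t *\<^sub>R v\<close> keeps
  their distance. So it suffices to follow \<open>v\<close> from base points in \<open>S\<close>, and
  the error is allowed to be \<open>o(t)\<close> uniformly in the base point.
\<close>

lemma clarke_tangent_coneI:
  fixes S :: "'a::euclidean_space set"
  assumes z: "z \<in> S"
    and tang: "\<And>\<epsilon>. \<epsilon> > 0 \<Longrightarrow>
      \<exists>r>0. \<forall>w\<in>S. \<forall>t. dist w z < r \<longrightarrow> 0 < t \<longrightarrow> t < r \<longrightarrow> infdist (w + t *\<^sub>R v) S \<le> \<epsilon> * t"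
  shows "v \<in> clarke_tangent_cone S z"
proof -
  define Q where "Q = (\<lambda>(y, t). ereal ((infdist (y + t *\<^sub>R v) S - infdist y S) / t))"
  define F where "F = nhds z \<times>\<^sub>F at_right (0::real)"
  have upper: "Limsup F Q \<le> ereal \<epsilon>" if "\<epsilon> > 0" for \<epsilon>
  proof -
    obtain r where r: "r > 0" and
      near: "\<And>w t. w \<in> S \<Longrightarrow> dist w z < r \<Longrightarrow> 0 < t \<Longrightarrow> t < r \<Longrightarrow> infdist (w + t *\<^sub>R v) S \<le> \<epsilon> * t"
      using tang[OF \<open>\<epsilon> > 0\<close>] by blast
    have "Q (y, t) \<le> ereal \<epsilon>" if y: "dist y z < r / 3" and t: "0 < t" "t < r" for y t
    proof -
      have "infdist (y + t *\<^sub>R v) S \<le> infdist y S + \<epsilon> * t + \<eta>" if "\<eta> > 0" for \<eta>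
      proof -
        have "min \<eta> (r / 3) > 0" using that r by simp
        then obtain w where w: "w \<in> S" "dist y w < infdist y S + min \<eta> (r / 3)"
          using infdist_approx z by blast
        have "infdist y S \<le> dist y z" using z by (rule infdist_le)
        then have "dist w z < r"
          using w(2) y dist_triangle[of w z y] by (simp add: dist_commute)
        then have "infdist (w + t *\<^sub>R v) S \<le> \<epsilon> * t"
          using near w(1) t by blast
        moreover have "infdist (y + t *\<^sub>R v) S \<le> infdist (w + t *\<^sub>R v) S + dist y w"
          using infdist_triangle[of "y + t *\<^sub>R v" S "w + t *\<^sub>R v"] by simp
        ultimately show ?thesis using w(2) by linarith
      qed
      then have "infdist (y + t *\<^sub>R v) S \<le> infdist y S + \<epsilon> * t"
        by (rule field_le_epsilon)
      then show ?thesis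
        using t by (simp add: Q_def pos_divide_le_eq)
    qed
    moreover have "\<forall>\<^sub>F y in nhds z. dist y z < r / 3"
      using r unfolding eventually_nhds_metric by (intro exI[of _ "r / 3"]) auto
    moreover have "\<forall>\<^sub>F t in at_right 0. 0 < t \<and> t < r"
      using r by (auto simp: eventually_at_right_field)
    ultimately have "\<forall>\<^sub>F p in F. Q p \<le> ereal \<epsilon>"
      unfolding F_def eventually_prod_filter by fast
    then show ?thesis by (rule Limsup_bounded)
  qed
  have "Limsup F Q \<le> 0"
    by (rule ereal_le_epsilon2) (use upper in auto)
  moreover have "\<not> Limsup F Q < 0"
  proof
    assume "Limsup F Q < 0"
    then have "\<forall>\<^sub>F p in F. Q p < 0" by (rule Limsup_lessD)
    then obtain P P' where P: "eventually P (nhds z)" and P': "eventually P' (at_right 0)"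
      and neg: "\<And>y t. P y \<Longrightarrow> P' t \<Longrightarrow> Q (y, t) < 0"
      unfolding F_def eventually_prod_filter by blast
    have "\<forall>\<^sub>F t::real in at_right 0. P' t \<and> 0 < t"
      using P' eventually_at_right_less by (rule eventually_conj)
    then obtain t :: real where t: "P' t" "0 < t"
      using eventually_happens[of _ "at_right (0::real)"] by auto
    have "Q (z, t) < 0" using neg eventually_nhds_x_imp_x[OF P] t by blast
    \<comment> \<open>The base point \<open>z\<close> itself lies in \<open>S\<close>, so there the difference quotient is nonnegative.\<close>
    moreover have "Q (z, t) \<ge> 0" using z t by (simp add: Q_def infdist_nonneg)
    ultimately show False by simp
  qed
  ultimately have "Limsup F Q = 0" by simp
  then show ?thesis
    by (simp add: clarke_tangent_cone_def clarke_dir_deriv_def Q_def F_def)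
qed

lemma epigraph_ext_add_indicator:
  "epigraph_ext (\<lambda>y. f y + convex_indicator X y) = {(u, r). u \<in> X \<and> f u \<le> ereal r}"
  by (auto simp: epigraph_ext_def convex_indicator_def split: if_splits)

text \<open>
  From a point \<open>(u, r)\<close> of the epigraph, paraconvexity along the segment from \<open>u\<close> to \<open>y\<close> gives
  points of the epigraph whose height decreases at rate \<open>r - f y - \<rho> * norm (u - y) powr (1 + \<nu>)\<close>,
  which depends continuously on \<open>(u, r)\<close> because it involves the height \<open>r\<close> and not \<open>f u\<close>.
  Hence a positive rate at \<open>(x, f x)\<close> stays bounded away from zero nearby.
\<close>

lemma stationary_point_gap_le:
  fixes f :: "'a::euclidean_space \<Rightarrow> ereal"
  assumes "convex X" and fin: "\<And>u. u \<in> X \<Longrightarrow> \<bar>f u\<bar> \<noteq> \<infinity>"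
    and para: "paraconvex_on X \<nu> \<rho> f" and "\<rho> \<ge> 0" "\<nu> > -1"
    and stat: "stationary_point f X x" and y: "y \<in> X"
  shows "real_of_ereal (f x) - real_of_ereal (f y) \<le> \<rho> * norm (x - y) powr (1 + \<nu>)"
proof (rule ccontr)
  define g where "g = (\<lambda>u. real_of_ereal (f u))"
  have fg: "f u = ereal (g u)" if "u \<in> X" for u
    using fin[OF that] by (simp add: g_def ereal_real)
  define h where "h = (\<lambda>w::'a \<times> real. g y - snd w + \<rho> * norm (fst w - y) powr (1 + \<nu>))"
  \<comment> \<open>Half the rate at \<open>(x, g x)\<close>, to leave room for the nearby base points.\<close>
  define s where "s = - h (x, g x) / 2"
  define S where "S = epigraph_ext (\<lambda>y. f y + convex_indicator X y)"
  assume "\<not> ?thesis"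
  then have s: "s > 0" by (simp add: s_def h_def g_def)
  have x: "x \<in> X" using stat by (simp add: stationary_point_def)
  have S: "S = {(u, r). u \<in> X \<and> g u \<le> r}"
    using fg by (auto simp: S_def epigraph_ext_add_indicator)

  have "(h \<longlongrightarrow> h (x, g x)) (nhds (x, g x))"
    unfolding h_def using \<open>\<nu> > -1\<close>
    by (intro tendsto_intros tendsto_powr') (auto intro!: filterlim_ident)
  then have "\<forall>\<^sub>F w in nhds (x, g x). h w < - s"
    by (rule order_tendstoD) (use s in \<open>simp add: s_def\<close>)
  then obtain r0 where r0: "r0 > 0" and h: "\<And>w. dist w (x, g x) < r0 \<Longrightarrow> h w < - s"
    by (auto simp: eventually_nhds_metric)

  have "(y - x, - s) \<in> clarke_tangent_cone S (x, g x)"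
  proof (rule clarke_tangent_coneI)
    show "(x, g x) \<in> S" using x by (simp add: S)
    fix \<epsilon> :: real assume "\<epsilon> > 0"
    define r where "r = Min {r0, \<epsilon>, 1}"
    have r: "r > 0" "r \<le> r0" "r \<le> \<epsilon>" "r \<le> 1" using r0 \<open>\<epsilon> > 0\<close> by (auto simp: r_def)
    have "infdist (w + t *\<^sub>R (y - x, - s)) S \<le> \<epsilon> * t"
      if w: "w \<in> S" "dist w (x, g x) < r" and t: "0 < t" "t < r" for w t
    proof -
      obtain u a where ua: "w = (u, a)" by (cases w)
      have u: "u \<in> X" "g u \<le> a" using w(1) by (auto simp: S ua)
      define p where "p = t *\<^sub>R y + (1 - t) *\<^sub>R u"
      have t1: "t \<in> {0..1}" using t r by auto
      have p: "p \<in> X" unfolding p_def using \<open>convex X\<close> y u t1 by (auto intro: convexD)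
      have "f p \<le> ereal t * f y + ereal (1 - t) * f u
          + ereal (\<rho> * min t (1 - t) * norm (y - u) powr (1 + \<nu>))"
        using para y u(1) t1 unfolding paraconvex_on_def p_def by blast
      then have "g p \<le> t * g y + (1 - t) * g u + \<rho> * min t (1 - t) * norm (u - y) powr (1 + \<nu>)"
        by (simp add: fg p y u norm_minus_commute)
      also have "\<dots> \<le> t * g y + (1 - t) * a + \<rho> * t * norm (u - y) powr (1 + \<nu>)"
        using u(2) t1 \<open>\<rho> \<ge> 0\<close> by (intro add_mono mult_mono mult_right_mono mult_left_mono) auto
      also have "\<dots> = a + t * h w" by (simp add: h_def ua algebra_simps)
      also have "\<dots> \<le> a - t * s"
        using h[of w] w(2) r t mult_left_mono[of "h w" "- s" t] by simp
      finally have "(p, a - t * s) \<in> S" using p by (simp add: S)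
      then have "infdist (w + t *\<^sub>R (y - x, - s)) S
          \<le> dist (w + t *\<^sub>R (y - x, - s)) (p, a - t * s)"
        by (rule infdist_le)
      \<comment> \<open>Following \<open>y - x\<close> from \<open>u\<close> may leave \<open>X\<close>; \<open>p\<close> follows \<open>y - u\<close> instead.\<close>
      also have "\<dots> = dist (p + t *\<^sub>R (u - x), a - t * s) (p, a - t * s)"
        by (simp add: ua p_def algebra_simps)
      also have "\<dots> = t * dist u x"
        using t by (simp add: dist_Pair_Pair dist_norm)
      also have "\<dots> \<le> t * \<epsilon>"
        using dist_fst_le[of w "(x, g x)"] w(2) r t by (intro mult_left_mono) (auto simp: ua)
      finally show ?thesis by (simp only: mult.commute)
    qed
    then show "\<exists>r>0. \<forall>w\<in>S. \<forall>t. dist w (x, g x) < r \<longrightarrow> 0 < t \<longrightarrow> t < r \<longrightarrow>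
        infdist (w + t *\<^sub>R (y - x, - s)) S \<le> \<epsilon> * t"
      using r(1) by blast
  qed
  moreover have "(0, -1) \<in> clarke_normal_cone S (x, g x)"
    using stat x by (simp add: stationary_point_def clarke_subdiff_def S_def g_def convex_indicator_def)
  ultimately have "(0::'a, -1::real) \<bullet> (y - x, - s) \<le> 0"
    unfolding clarke_normal_cone_def by blast
  then show False using s by simp
qed

text \<open>
  The infimum defining \<open>infdist\<close> need not be attained, so the bound is passed to the limit
  through the root of order \<open>p\<close>, which isolates the distance.
\<close>

lemma le_powr_infdist:
  fixes c p :: real
  assumes "A \<noteq> {}" "c \<ge> 0" "p > 0" and "\<And>a. a \<in> A \<Longrightarrow> c \<le> dist x a powr p"
  shows "c \<le> infdist x A powr p"
proof -
  have "c powr (1 / p) \<le> dist x a" if "a \<in> A" for a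
    using powr_mono2[of "1 / p" c "dist x a powr p"] assms that by (simp add: powr_powr)
  then have "c powr (1 / p) \<le> infdist x A"
    using assms(1) by (auto simp: infdist_notempty intro: cINF_greatest)
  then have "(c powr (1 / p)) powr p \<le> infdist x A powr p"
    using assms by (intro powr_mono2) auto
  then show ?thesis using assms by (simp add: powr_powr)
qed

theorem lemma3p17:
  fixes f :: "real ^ 'n \<Rightarrow> ereal"
    and X X' :: "(real ^ 'n) set"
    and \<rho> \<nu> \<delta> \<mu> :: real
    and x :: "real ^ 'n"
  assumes "proper f"
    and "X \<subseteq> effective_dom f" and "X \<noteq> {}" and "closed X" and "convex X"
    and "minimizers f X \<noteq> {}"
    and "\<rho> > 0" and "0 < \<nu>" and "\<nu> \<le> 1"
    and "1 / (1 + \<nu>) < \<delta>" and "\<delta> \<le> 1" and "\<mu> > 0"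
    and "open X'" and "convex X'" and "X \<subseteq> X'" and "X' \<subseteq> effective_dom f"
    and "paraconvex_on X' \<nu> \<rho> f"
    and "holder_error_bound_on X \<delta> \<mu> f"
    and "stationary_point f X x"
  shows "x \<in> minimizers f X \<or>
         (\<mu> / \<rho>) powr (\<delta> / (\<delta> * (1 + \<nu>) - 1)) \<le> infdist x (minimizers f X)"
proof (subst disj_imp, rule impI)
  assume nonmin: "x \<notin> minimizers f X"
  define M where "M = minimizers f X"
  define g where "g = (\<lambda>u. real_of_ereal (f u))"
  define D where "D = infdist x M"
  have fin: "\<bar>f u\<bar> \<noteq> \<infinity>" if "u \<in> X" for u
    using assms(1,2) that by (auto simp: proper_def effective_dom_def)
  have fg: "f u = ereal (g u)" if "u \<in> X" for u
    using fin[OF that] by (simp add: g_def ereal_real)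
  have x: "x \<in> X" using assms(19) by (simp add: stationary_point_def)
  obtain m where m: "m \<in> M" using assms(6) by (auto simp: M_def)
  have M: "a \<in> M \<longleftrightarrow> a \<in> X \<and> (\<forall>u\<in>X. g a \<le> g u)" for a
    using fg by (auto simp: M_def minimizers_def is_arg_min_def not_less)
  have gap_pos: "g m < g x"
    using nonmin x m by (auto simp: M M_def[symmetric])
  have "min_value f X = f m"
    unfolding min_value_def using m by (intro cInf_eq_minimum) (auto simp: M fg)
  then have err: "\<mu> * D powr (1 / \<delta>) \<le> g x - g m"
    using assms(18) x m by (auto simp: holder_error_bound_on_def D_def M_def[symmetric] M fg)

  have "paraconvex_on X \<nu> \<rho> f"
    using assms(15,17) unfolding paraconvex_on_def by blast
  then have "g x - g a \<le> \<rho> * norm (x - a) powr (1 + \<nu>)" if "a \<in> M" for a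
    unfolding g_def using that assms(5,7,8,19) fin
    by (intro stationary_point_gap_le) (auto simp: M)
  moreover have "g a = g m" if "a \<in> M" for a
    using that m by (auto simp: M intro: antisym)
  ultimately have "(g x - g m) / \<rho> \<le> dist x a powr (1 + \<nu>)" if "a \<in> M" for a
    using that \<open>\<rho> > 0\<close> by (auto simp: dist_norm pos_divide_le_eq mult.commute)
  then have gap: "(g x - g m) / \<rho> \<le> D powr (1 + \<nu>)"
    unfolding D_def using m gap_pos \<open>\<rho> > 0\<close> \<open>0 < \<nu>\<close> by (intro le_powr_infdist) auto
  \<comment> \<open>The convention \<open>0 powr p = 0\<close> turns the positive gap into a positive distance.\<close>
  have "(g x - g m) / \<rho> > 0" using gap_pos \<open>\<rho> > 0\<close> by simp
  with gap have "D \<noteq> 0" by auto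
  then have D: "D > 0" using infdist_nonneg[of x M] by (simp add: D_def)

  define e where "e = 1 + \<nu> - 1 / \<delta>"
  have \<delta>: "\<delta> > 0" using assms(8,10) by (smt (verit) divide_pos_pos)
  have e: "e > 0" using assms(8,10) \<delta> by (simp add: e_def field_simps)
  have exponent: "\<delta> / (\<delta> * (1 + \<nu>) - 1) = 1 / e"
    using \<delta> by (simp add: e_def field_simps)
  have "\<mu> * D powr (1 / \<delta>) \<le> \<rho> * D powr (1 + \<nu>)"
    using err gap \<open>\<rho> > 0\<close> by (simp add: pos_divide_le_eq mult.commute)
  also have "D powr (1 + \<nu>) = D powr e * D powr (1 / \<delta>)"
    by (simp add: e_def powr_add[symmetric])
  finally have "\<mu> / \<rho> \<le> D powr e"
    using D \<open>\<rho> > 0\<close> by (simp add: pos_divide_le_eq mult.commute mult.left_commute)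
  then have "(\<mu> / \<rho>) powr (1 / e) \<le> (D powr e) powr (1 / e)"
    using e \<open>\<mu> > 0\<close> \<open>\<rho> > 0\<close> by (intro powr_mono2) auto
  then show "(\<mu> / \<rho>) powr (\<delta> / (\<delta> * (1 + \<nu>) - 1)) \<le> infdist x (minimizers f X)"
    unfolding exponent using e D by (simp add: powr_powr D_def M_def)
qed

end
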